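(* Let $\mathbb{C}=(C,\otimes,I)$ be a monoidal category and let $\mathsf{S}=(S,\mu)$ be a semigroup object in $\mathbb{C}$. Then $\mathsf{Mult}_{\mathbb{C}}(\mathsf{S}):=(\mathit{Mult}_{\mathbb{C}}(\mathsf{S}),\star,(id_S,id_S))$ is a monoid under $(L',R')\star(L,R):=(L'\circ L,R\circ R')$. In fact, $\mathit{Mult}_{\mathbb{C}}(\mathsf{S})$ is a submonoid of the product monoid $\mathbf{Act}_{\mathsf{S}}(\mathbb{C})((S,\mu),(S,\mu))\times {}_{\mathsf{S}}\mathbf{Act}(\mathbb{C})((S,\mu),(S,\mu))^{op}$.
   Context: A semigroup object in $\mathbb{C}$ is a pair $\mathsf{S}=(S,\mu\colon S\otimes S\to S)$ with $\mu$ associative (no unit required). $\mathbf{Act}_{\mathsf{S}}(\mathbb{C})((S,\mu),(S,\mu))$ is the monoid, under composition, of $C$-morphisms $L\colon S\to S$ with $L\circ\mu=\mu\circ(L\otimes id_S)$ (endomorphisms of $S$ as a right $\mathsf{S}$-act), and ${}_{\mathsf{S}}\mathbf{Act}(\mathbb{C})((S,\mu),(S,\mu))$ is the monoid, under composition, of $C$-morphisms $R\colon S\to S$ with $R\circ\mu=\mu\circ(id_S\otimes R)$ (endomorphisms of $S$ as a left $\mathsf{S}$-act). $(-)^{op}$ denotes the opposite monoid. $\mathit{Mult}_{\mathbb{C}}(\mathsf{S})$ is the set of pairs $(L,R)\in \mathbf{Act}_{\mathsf{S}}(\mathbb{C})((S,\mu),(S,\mu))\times{}_{\mathsf{S}}\mathbf{Act}(\mathbb{C})((S,\mu),(S,\mu))$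 such that $\mu\circ(id_S\otimes L)=\mu\circ(R\otimes id_S)$; its elements are called multipliers of $\mathsf{S}$. *)

theory Defs
  imports "HOL-Algebra.Group"
begin

record ('o, 'm) category =
  Ob :: "'o set"
  Mor :: "'m set"
  Dom :: "'m \<Rightarrow> 'o"
  Cod :: "'m \<Rightarrow> 'o"
  Id :: "'o \<Rightarrow> 'm" (\<open>\<i>\<d>\<index>\<close>)
  Comp :: "'m \<Rightarrow> 'm \<Rightarrow> 'm" (infixr \<open>\<cdot>\<index>\<close> 65)

text \<open>
  \<open>g \<cdot>\<^bsub>C\<^esub> f\<close> is the composite "g after f"; it is meaningful only if
  \<open>Dom C g = Cod C f\<close>.
\<close>

definition Hom :: "('o, 'm, 'z) category_scheme \<Rightarrow> 'o \<Rightarrow> 'o \<Rightarrow> 'm set" where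
  "Hom C A B = {f \<in> Mor C. Dom C f = A \<and> Cod C f = B}"

locale category =
  fixes C (structure)
  assumes Dom_Ob: "f \<in> Mor C \<Longrightarrow> Dom C f \<in> Ob C"
    and Cod_Ob: "f \<in> Mor C \<Longrightarrow> Cod C f \<in> Ob C"
    and Id_Hom: "A \<in> Ob C \<Longrightarrow> \<i>\<d> A \<in> Hom C A A"
    and Comp_Hom: "f \<in> Hom C A B \<Longrightarrow> g \<in> Hom C B D \<Longrightarrow> g \<cdot> f \<in> Hom C A D"
    and Comp_Id_left: "f \<in> Hom C A B \<Longrightarrow> \<i>\<d> B \<cdot> f = f"
    and Comp_Id_right: "f \<in> Hom C A B \<Longrightarrow> f \<cdot> \<i>\<d> A = f"
    and Comp_assoc: "f \<in> Hom C A B \<Longrightarrow> g \<in> Hom C B D \<Longrightarrow> h \<in> Hom C D E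
      \<Longrightarrow> (h \<cdot> g) \<cdot> f = h \<cdot> (g \<cdot> f)"

definition Iso :: "('o, 'm, 'z) category_scheme \<Rightarrow> 'o \<Rightarrow> 'o \<Rightarrow> 'm set" where
  "Iso C A B = {f \<in> Hom C A B.
     \<exists>g \<in> Hom C B A. g \<cdot>\<^bsub>C\<^esub> f = \<i>\<d>\<^bsub>C\<^esub> A \<and> f \<cdot>\<^bsub>C\<^esub> g = \<i>\<d>\<^bsub>C\<^esub> B}"

record ('o, 'm) monoidal_category = "('o, 'm) category" +
  Tensor_Ob :: "'o \<Rightarrow> 'o \<Rightarrow> 'o" (infixr \<open>\<otimes>\<^sub>o\<index>\<close> 70)
  Tensor_Mor :: "'m \<Rightarrow> 'm \<Rightarrow> 'm" (infixr \<open>\<otimes>\<^sub>m\<index>\<close> 70)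
  Unit_Ob :: "'o" (\<open>\<I>\<index>\<close>)
  Associator :: "'o \<Rightarrow> 'o \<Rightarrow> 'o \<Rightarrow> 'm" (\<open>\<a>\<index>\<close>)
  Left_Unitor :: "'o \<Rightarrow> 'm" (\<open>\<l>\<index>\<close>)
  Right_Unitor :: "'o \<Rightarrow> 'm" (\<open>\<r>\<index>\<close>)

text \<open>
  Monoidal categories are not assumed to be strict.
\<close>

locale monoidal_category = category C for C (structure) +
  assumes Tensor_Ob_closed: "A \<in> Ob C \<Longrightarrow> B \<in> Ob C \<Longrightarrow> A \<otimes>\<^sub>o B \<in> Ob C"
    and Tensor_Mor_Hom: "f \<in> Hom C A A' \<Longrightarrow> g \<in> Hom C B B'
      \<Longrightarrow> f \<otimes>\<^sub>m g \<in> Hom C (A \<otimes>\<^sub>o B) (A' \<otimes>\<^sub>o B')"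
    and Tensor_Id: "A \<in> Ob C \<Longrightarrow> B \<in> Ob C \<Longrightarrow> \<i>\<d> A \<otimes>\<^sub>m \<i>\<d> B = \<i>\<d> (A \<otimes>\<^sub>o B)"
    and Tensor_Comp: "f \<in> Hom C A A' \<Longrightarrow> f' \<in> Hom C A' A''
      \<Longrightarrow> g \<in> Hom C B B' \<Longrightarrow> g' \<in> Hom C B' B''
      \<Longrightarrow> (f' \<cdot> f) \<otimes>\<^sub>m (g' \<cdot> g) = (f' \<otimes>\<^sub>m g') \<cdot> (f \<otimes>\<^sub>m g)"
    and Unit_Ob_closed: "\<I> \<in> Ob C"
    and Associator_Iso: "A \<in> Ob C \<Longrightarrow> B \<in> Ob C \<Longrightarrow> D \<in> Ob C
      \<Longrightarrow> \<a> A B D \<in> Iso C ((A \<otimes>\<^sub>o B) \<otimes>\<^sub>o D) (A \<otimes>\<^sub>o (B \<otimes>\<^sub>o D))"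
    and Associator_natural: "f \<in> Hom C A A' \<Longrightarrow> g \<in> Hom C B B' \<Longrightarrow> h \<in> Hom C D D'
      \<Longrightarrow> \<a> A' B' D' \<cdot> ((f \<otimes>\<^sub>m g) \<otimes>\<^sub>m h) = (f \<otimes>\<^sub>m (g \<otimes>\<^sub>m h)) \<cdot> \<a> A B D"
    and Left_Unitor_Iso: "A \<in> Ob C \<Longrightarrow> \<l> A \<in> Iso C (\<I> \<otimes>\<^sub>o A) A"
    and Left_Unitor_natural: "f \<in> Hom C A A' \<Longrightarrow> \<l> A' \<cdot> (\<i>\<d> \<I> \<otimes>\<^sub>m f) = f \<cdot> \<l> A"
    and Right_Unitor_Iso: "A \<in> Ob C \<Longrightarrow> \<r> A \<in> Iso C (A \<otimes>\<^sub>o \<I>) A"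
    and Right_Unitor_natural: "f \<in> Hom C A A' \<Longrightarrow> \<r> A' \<cdot> (f \<otimes>\<^sub>m \<i>\<d> \<I>) = f \<cdot> \<r> A"
    and pentagon: "A \<in> Ob C \<Longrightarrow> B \<in> Ob C \<Longrightarrow> D \<in> Ob C \<Longrightarrow> E \<in> Ob C
      \<Longrightarrow> (\<i>\<d> A \<otimes>\<^sub>m \<a> B D E) \<cdot> \<a> A (B \<otimes>\<^sub>o D) E \<cdot> (\<a> A B D \<otimes>\<^sub>m \<i>\<d> E)
        = \<a> A B (D \<otimes>\<^sub>o E) \<cdot> \<a> (A \<otimes>\<^sub>o B) D E"
    and triangle: "A \<in> Ob C \<Longrightarrow> B \<in> Ob C
      \<Longrightarrow> (\<i>\<d> A \<otimes>\<^sub>m \<l> B) \<cdot> \<a> A \<I> B = \<r> A \<otimes>\<^sub>m \<i>\<d> B"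

definition semigroup_object ::
    "('o, 'm, 'z) monoidal_category_scheme \<Rightarrow> 'o \<Rightarrow> 'm \<Rightarrow> bool" where
  "semigroup_object C S \<mu> \<longleftrightarrow>
     S \<in> Ob C \<and> \<mu> \<in> Hom C (S \<otimes>\<^sub>o\<^bsub>C\<^esub> S) S \<and>
     \<mu> \<cdot>\<^bsub>C\<^esub> (\<mu> \<otimes>\<^sub>m\<^bsub>C\<^esub> \<i>\<d>\<^bsub>C\<^esub> S)
       = \<mu> \<cdot>\<^bsub>C\<^esub> (\<i>\<d>\<^bsub>C\<^esub> S \<otimes>\<^sub>m\<^bsub>C\<^esub> \<mu>) \<cdot>\<^bsub>C\<^esub> \<a>\<^bsub>C\<^esub> S S S"

text \<open>
  The endomorphism monoids of \<open>(S, \<mu>)\<close> as a right and as a left act over itself.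
\<close>

definition right_act_End ::
    "('o, 'm, 'z) monoidal_category_scheme \<Rightarrow> 'o \<Rightarrow> 'm \<Rightarrow> 'm monoid" where
  "right_act_End C S \<mu> =
     \<lparr>carrier = {L \<in> Hom C S S. L \<cdot>\<^bsub>C\<^esub> \<mu> = \<mu> \<cdot>\<^bsub>C\<^esub> (L \<otimes>\<^sub>m\<^bsub>C\<^esub> \<i>\<d>\<^bsub>C\<^esub> S)},
      mult = (\<lambda>L' L. L' \<cdot>\<^bsub>C\<^esub> L),
      one = \<i>\<d>\<^bsub>C\<^esub> S\<rparr>"

definition left_act_End ::
    "('o, 'm, 'z) monoidal_category_scheme \<Rightarrow> 'o \<Rightarrow> 'm \<Rightarrow> 'm monoid" where
  "left_act_End C S \<mu> =
     \<lparr>carrier = {R \<in> Hom C S S. R \<cdot>\<^bsub>C\<^esub> \<mu> = \<mu> \<cdot>\<^bsub>C\<^esub> (\<i>\<d>\<^bsub>C\<^esub> S \<otimes>\<^sub>m\<^bsub>C\<^esub> R)},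
      mult = (\<lambda>R' R. R' \<cdot>\<^bsub>C\<^esub> R),
      one = \<i>\<d>\<^bsub>C\<^esub> S\<rparr>"

definition op_monoid :: "('a, 'z) monoid_scheme \<Rightarrow> 'a monoid" where
  "op_monoid G = \<lparr>carrier = carrier G, mult = (\<lambda>x y. y \<otimes>\<^bsub>G\<^esub> x), one = \<one>\<^bsub>G\<^esub>\<rparr>"

definition multipliers ::
    "('o, 'm, 'z) monoidal_category_scheme \<Rightarrow> 'o \<Rightarrow> 'm \<Rightarrow> ('m \<times> 'm) set" where
  "multipliers C S \<mu> =
     {(L, R) \<in> carrier (right_act_End C S \<mu>) \<times> carrier (left_act_End C S \<mu>).
        \<mu> \<cdot>\<^bsub>C\<^esub> (\<i>\<d>\<^bsub>C\<^esub> S \<otimes>\<^sub>m\<^bsub>C\<^esub> L) = \<mu> \<cdot>\<^bsub>C\<^esub> (R \<otimes>\<^sub>m\<^bsub>C\<^esub> \<i>\<d>\<^bsub>C\<^esub> S)}"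

definition multiplier_monoid ::
    "('o, 'm, 'z) monoidal_category_scheme \<Rightarrow> 'o \<Rightarrow> 'm \<Rightarrow> ('m \<times> 'm) monoid" where
  "multiplier_monoid C S \<mu> =
     \<lparr>carrier = multipliers C S \<mu>,
      mult = (\<lambda>(L', R') (L, R). (L' \<cdot>\<^bsub>C\<^esub> L, R \<cdot>\<^bsub>C\<^esub> R')),
      one = (\<i>\<d>\<^bsub>C\<^esub> S, \<i>\<d>\<^bsub>C\<^esub> S)\<rparr>"

end

theory Submission
  imports Defs
begin

text \<open>Once the multipliers are seen to be a submonoid of the product, all monoid laws for the
  starred product are inherited, so only closure under the unit and under products needs an
  argument. Endomorphisms of a one-sided act compose because tensoring with \<open>S\<close> on
  either side is functorial (\<open>right_act_End_comp\<close>, \<open>left_act_End_comp\<close>).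
  The compatibility between \<open>L\<close> and \<open>R\<close> survives multiplication because
  morphisms acting on different tensor factors commute (\<open>Tensor_interchange\<close>, used in
  \<open>multiplier_comp\<close>). Passing a composite through this compatibility reverses its
  order, which is why the second factor of the product carries the opposite multiplication.\<close>

lemma (in monoidal_category) Tensor_Comp_Id_right:
  assumes "f \<in> Hom C A B" "g \<in> Hom C B D" "E \<in> Ob C"
  shows "(g \<cdot> f) \<otimes>\<^sub>m \<i>\<d> E = (g \<otimes>\<^sub>m \<i>\<d> E) \<cdot> (f \<otimes>\<^sub>m \<i>\<d> E)"
  using Tensor_Comp[OF assms(1,2) Id_Hom Id_Hom] Comp_Id_left[OF Id_Hom] assms(3) by metis

lemma (in monoidal_category) Tensor_Comp_Id_left:
  assumes "f \<in> Hom C A B" "g \<in> Hom C B D" "E \<in> Ob C"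
  shows "\<i>\<d> E \<otimes>\<^sub>m (g \<cdot> f) = (\<i>\<d> E \<otimes>\<^sub>m g) \<cdot> (\<i>\<d> E \<otimes>\<^sub>m f)"
  using Tensor_Comp[OF Id_Hom Id_Hom assms(1,2)] Comp_Id_left[OF Id_Hom] assms(3) by metis

text \<open>By bifunctoriality both composites equal \<open>f \<otimes>\<^sub>m g\<close>.\<close>

lemma (in monoidal_category) Tensor_interchange:
  assumes "f \<in> Hom C A A'" "g \<in> Hom C B B'" "A \<in> Ob C" "A' \<in> Ob C" "B \<in> Ob C" "B' \<in> Ob C"
  shows "(f \<otimes>\<^sub>m \<i>\<d> B') \<cdot> (\<i>\<d> A \<otimes>\<^sub>m g) = (\<i>\<d> A' \<otimes>\<^sub>m g) \<cdot> (f \<otimes>\<^sub>m \<i>\<d> B)"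
  using Tensor_Comp[OF Id_Hom assms(1) assms(2) Id_Hom]
    Tensor_Comp[OF assms(1) Id_Hom Id_Hom assms(2)]
    Comp_Id_left Comp_Id_right assms by metis

lemma monoid_op_monoid:
  assumes "monoid G"
  shows "monoid (op_monoid G)"
proof -
  interpret G: monoid G by fact
  show ?thesis
    by (rule monoidI) (simp_all add: op_monoid_def G.m_assoc)
qed

locale magma_in_monoidal_category = monoidal_category C for C (structure) +
  fixes S \<mu>
  assumes Ob_S: "S \<in> Ob C"
    and \<mu>_Hom: "\<mu> \<in> Hom C (S \<otimes>\<^sub>o S) S"
begin

lemmas Id_S = Id_Hom[OF Ob_S]

text \<open>First \<open>L\<close>, then \<open>L'\<close>, is moved through \<mu>; the two
  resulting tensor factors fuse by functoriality of tensoring with \<open>S\<close> on the right.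
  The left-act version is the mirror image.\<close>

lemma right_act_End_comp:
  assumes "L \<in> Hom C S S" "L \<cdot> \<mu> = \<mu> \<cdot> (L \<otimes>\<^sub>m \<i>\<d> S)"
    and "L' \<in> Hom C S S" "L' \<cdot> \<mu> = \<mu> \<cdot> (L' \<otimes>\<^sub>m \<i>\<d> S)"
  shows "(L' \<cdot> L) \<cdot> \<mu> = \<mu> \<cdot> ((L' \<cdot> L) \<otimes>\<^sub>m \<i>\<d> S)"
proof -
  note T = Tensor_Mor_Hom[OF assms(1) Id_S] Tensor_Mor_Hom[OF assms(3) Id_S]
  have "(L' \<cdot> L) \<cdot> \<mu> = L' \<cdot> \<mu> \<cdot> (L \<otimes>\<^sub>m \<i>\<d> S)"
    using Comp_assoc[OF \<mu>_Hom assms(1,3)] assms(2) by simp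
  also have "\<dots> = (\<mu> \<cdot> (L' \<otimes>\<^sub>m \<i>\<d> S)) \<cdot> (L \<otimes>\<^sub>m \<i>\<d> S)"
    using Comp_assoc[OF T(1) \<mu>_Hom assms(3)] assms(4) by simp
  also have "\<dots> = \<mu> \<cdot> ((L' \<cdot> L) \<otimes>\<^sub>m \<i>\<d> S)"
    using Comp_assoc[OF T(1) T(2) \<mu>_Hom] Tensor_Comp_Id_right[OF assms(1,3) Ob_S] by simp
  finally show ?thesis .
qed

lemma left_act_End_comp:
  assumes "R \<in> Hom C S S" "R \<cdot> \<mu> = \<mu> \<cdot> (\<i>\<d> S \<otimes>\<^sub>m R)"
    and "R' \<in> Hom C S S" "R' \<cdot> \<mu> = \<mu> \<cdot> (\<i>\<d> S \<otimes>\<^sub>m R')"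
  shows "(R' \<cdot> R) \<cdot> \<mu> = \<mu> \<cdot> (\<i>\<d> S \<otimes>\<^sub>m (R' \<cdot> R))"
proof -
  note T = Tensor_Mor_Hom[OF Id_S assms(1)] Tensor_Mor_Hom[OF Id_S assms(3)]
  have "(R' \<cdot> R) \<cdot> \<mu> = R' \<cdot> \<mu> \<cdot> (\<i>\<d> S \<otimes>\<^sub>m R)"
    using Comp_assoc[OF \<mu>_Hom assms(1,3)] assms(2) by simp
  also have "\<dots> = (\<mu> \<cdot> (\<i>\<d> S \<otimes>\<^sub>m R')) \<cdot> (\<i>\<d> S \<otimes>\<^sub>m R)"
    using Comp_assoc[OF T(1) \<mu>_Hom assms(3)] assms(4) by simp
  also have "\<dots> = \<mu> \<cdot> (\<i>\<d> S \<otimes>\<^sub>m (R' \<cdot> R))"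
    using Comp_assoc[OF T(1) T(2) \<mu>_Hom] Tensor_Comp_Id_left[OF assms(1,3) Ob_S] by simp
  finally show ?thesis .
qed

text \<open>This one equation is the equivariance condition of the identity both for the right and
  for the left act, so it provides the unit of each endomorphism monoid and of the
  multipliers.\<close>

lemma Id_S_comp_\<mu>: "\<i>\<d> S \<cdot> \<mu> = \<mu> \<cdot> (\<i>\<d> S \<otimes>\<^sub>m \<i>\<d> S)"
  using Comp_Id_left[OF \<mu>_Hom] Comp_Id_right[OF \<mu>_Hom] Tensor_Id[OF Ob_S Ob_S] by simp

lemma monoid_right_act_End: "monoid (right_act_End C S \<mu>)"
  by (rule monoidI)
    (auto simp: right_act_End_def Id_S Id_S_comp_\<mu> right_act_End_comp
      intro: Comp_Hom Comp_assoc Comp_Id_left Comp_Id_right)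

lemma monoid_left_act_End: "monoid (left_act_End C S \<mu>)"
  by (rule monoidI)
    (auto simp: left_act_End_def Id_S Id_S_comp_\<mu> left_act_End_comp
      intro: Comp_Hom Comp_assoc Comp_Id_left Comp_Id_right)

text \<open>Next to \<mu>, a map on the right factor can be traded for its partner on the left
  factor. Trading \<open>L'\<close> first leaves \<open>R'\<close> in front of \<open>L\<close>, so
  \<open>R\<close> ends up applied after \<open>R'\<close>.\<close>

lemma multiplier_comp:
  assumes "L \<in> Hom C S S" "R \<in> Hom C S S" "L' \<in> Hom C S S" "R' \<in> Hom C S S"
    and LR: "\<mu> \<cdot> (\<i>\<d> S \<otimes>\<^sub>m L) = \<mu> \<cdot> (R \<otimes>\<^sub>m \<i>\<d> S)"
    and LR': "\<mu> \<cdot> (\<i>\<d> S \<otimes>\<^sub>m L') = \<mu> \<cdot> (R' \<otimes>\<^sub>m \<i>\<d> S)"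
  shows "\<mu> \<cdot> (\<i>\<d> S \<otimes>\<^sub>m (L' \<cdot> L)) = \<mu> \<cdot> ((R \<cdot> R') \<otimes>\<^sub>m \<i>\<d> S)"
proof -
  note TL = Tensor_Mor_Hom[OF Id_S assms(1)] Tensor_Mor_Hom[OF Id_S assms(3)]
  note TR = Tensor_Mor_Hom[OF assms(2) Id_S] Tensor_Mor_Hom[OF assms(4) Id_S]
  have "\<mu> \<cdot> (\<i>\<d> S \<otimes>\<^sub>m (L' \<cdot> L)) = (\<mu> \<cdot> (\<i>\<d> S \<otimes>\<^sub>m L')) \<cdot> (\<i>\<d> S \<otimes>\<^sub>m L)"
    using Tensor_Comp_Id_left[OF assms(1,3) Ob_S] Comp_assoc[OF TL \<mu>_Hom] by simp
  also have "\<dots> = \<mu> \<cdot> (R' \<otimes>\<^sub>m \<i>\<d> S) \<cdot> (\<i>\<d> S \<otimes>\<^sub>m L)"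
    using LR' Comp_assoc[OF TL(1) TR(2) \<mu>_Hom] by simp
  \<comment> \<open>\<open>R'\<close> and \<open>L\<close> live on different tensor factors, so they
    can be swapped; this puts \<open>L\<close> next to \<mu>, where \<open>LR\<close>
    applies.\<close>
  also have "\<dots> = \<mu> \<cdot> (\<i>\<d> S \<otimes>\<^sub>m L) \<cdot> (R' \<otimes>\<^sub>m \<i>\<d> S)"
    using Tensor_interchange[OF assms(4) assms(1) Ob_S Ob_S Ob_S Ob_S] by simp
  also have "\<dots> = (\<mu> \<cdot> (R \<otimes>\<^sub>m \<i>\<d> S)) \<cdot> (R' \<otimes>\<^sub>m \<i>\<d> S)"
    using LR Comp_assoc[OF TR(2) TL(1) \<mu>_Hom] by simp
  also have "\<dots> = \<mu> \<cdot> ((R \<cdot> R') \<otimes>\<^sub>m \<i>\<d> S)"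
    using Tensor_Comp_Id_right[OF assms(4,2) Ob_S] Comp_assoc[OF TR(2) TR(1) \<mu>_Hom] by simp
  finally show ?thesis .
qed

lemma submonoid_multipliers:
  "submonoid (multipliers C S \<mu>) (right_act_End C S \<mu> \<times>\<times> op_monoid (left_act_End C S \<mu>))"
proof
  show "multipliers C S \<mu> \<subseteq> carrier (right_act_End C S \<mu> \<times>\<times> op_monoid (left_act_End C S \<mu>))"
    by (auto simp: multipliers_def op_monoid_def DirProd_def)
  show "\<one>\<^bsub>right_act_End C S \<mu> \<times>\<times> op_monoid (left_act_End C S \<mu>)\<^esub> \<in> multipliers C S \<mu>"
    by (simp add: multipliers_def op_monoid_def DirProd_def right_act_End_def left_act_End_def
        Id_S Id_S_comp_\<mu>)
  show "x \<otimes>\<^bsub>right_act_End C S \<mu> \<times>\<times> op_monoid (left_act_End C S \<mu>)\<^esub> y \<in> multipliers C S \<mu>"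
    if "x \<in> multipliers C S \<mu>" "y \<in> multipliers C S \<mu>" for x y
    using that
    by (auto simp: multipliers_def op_monoid_def DirProd_def right_act_End_def left_act_End_def
        right_act_End_comp left_act_End_comp multiplier_comp intro: Comp_Hom)
qed

end

text \<open>Unfolding the opposite multiplication in the second component yields exactly the starred
  product, with the same unit, so facts about the submonoid transfer to
  \<open>multiplier_monoid\<close>.\<close>

lemma multiplier_monoid_eq:
  "multiplier_monoid C S \<mu> =
     (right_act_End C S \<mu> \<times>\<times> op_monoid (left_act_End C S \<mu>))\<lparr>carrier := multipliers C S \<mu>\<rparr>"
  by (simp add: multiplier_monoid_def DirProd_def op_monoid_def right_act_End_def left_act_End_def)

theorem proposition10:
  fixes C :: "('o, 'm, 'z) monoidal_category_scheme" and S :: 'o and \<mu> :: 'm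
  assumes "monoidal_category C"
    and "semigroup_object C S \<mu>"
  shows "monoid (multiplier_monoid C S \<mu>)
    \<and> monoid (right_act_End C S \<mu> \<times>\<times> op_monoid (left_act_End C S \<mu>))
    \<and> submonoid (multipliers C S \<mu>)
        (right_act_End C S \<mu> \<times>\<times> op_monoid (left_act_End C S \<mu>))
    \<and> multiplier_monoid C S \<mu> =
        (right_act_End C S \<mu> \<times>\<times> op_monoid (left_act_End C S \<mu>))
          \<lparr>carrier := multipliers C S \<mu>\<rparr>"
proof -
  interpret monoidal_category C by fact
  interpret magma_in_monoidal_category C S \<mu>
    by unfold_locales (use assms(2) in \<open>simp_all add: semigroup_object_def\<close>)
  have P: "monoid (right_act_End C S \<mu> \<times>\<times> op_monoid (left_act_End C S \<mu>))"
    by (intro DirProd_monoid monoid_op_monoid monoid_right_act_End monoid_left_act_End)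
  show ?thesis
    using P submonoid.submonoid_is_monoid[OF submonoid_multipliers P] submonoid_multipliers
      multiplier_monoid_eq[of C S \<mu>] by simp
qed

end
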